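(* Let $v_0\in[0,1)$, let $D$ be a descent kernel, and let $X$ be a $(v_0,D)$-pushable sequence. Set $Y=X.D$, i.e. $Y_a=\sum_{b\ge a}X_bD_{b,a}$, and $$v_{a+1}=\frac{X_{a+1}}{Y_{a+1}/Y_0+X_a(1/v_a-1)}\quad\text{for all }a\ge0$$ (if $v_0=0$, take $v_1=\frac{X_1}{Y_0}\big(1-\frac{Y_1}{Y_0+Y_1}\big)=\frac{X_1}{Y_0+Y_1}$ instead). Then $v_a\in(0,1)$ for all $a>0$, this being equivalent to the condition that $\sum_{i=1}^{a}(Y_i/Y_0-X_i)>0$ for all $a\geq 1$. Define the 4-tuple of sequences $[u,\alpha,\beta,\pi]$ by $\pi_0=Y_0$, $u_0=1$ and, for $a\ge0$, $$u_{a+1}=\frac{Y_{a+1}u_a}{Y_a(1-v_a)+Y_{a+1}u_a},\qquad \pi_{a+1}=\pi_a\frac{1-v_a}{1-u_{a+1}},\qquad \beta_a=X_a,\qquad \alpha_a=\frac{1}{u_a\pi_a}.$$ Then the almost lower-triangular transition matrix $L$ with descent representation $(v,D)$ has as time-reversal the matrix $U$ defined by $$U_{a,b}=u_a\,\alpha_a\beta_b\,D_{b,a}\ \text{ for } b\ge a,\qquad U_{a,a-1}=1-u_a\ \text{ for } a\ge 0,$$ and both transition matrices $L$ and $U$ have $\pi$ as invariant measure.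
   Context: $\mathbb N=\{0,1,2,\dots\}$. A descent kernel $D=[D_{i,j}]_{i,j\ge0}$ is a lower triangular transition matrix on $\mathbb N$: non-negative entries, $D_{i,j}>0\Rightarrow j\le i$, rows summing to $1$. Given $v_0\in[0,1)$ and a descent kernel $D$, a sequence $X=(X_a,a\ge0)$ is $(v_0,D)$-pushable if: $X_0=v_0$ and $X_i>0$ for all $i\ge1$; for all $a\ge0$, $Y_a:=\sum_{b\ge a}X_bD_{b,a}$ is finite (written $Y=X.D$); and for all $a\ge1$, $\sum_{i=1}^{a}(Y_i/Y_0-X_i)>0$. The transition matrix $L$ with descent representation $(v,D)$, $v=(v_a,a\ge0)$, is given by $L_{b,a}=v_bD_{b,a}$ for $b\ge a$ and $L_{b,b+1}=1-v_b$ for $b\ge0$ (other entries zero). $U$ is a time-reversal of $L$ if there is a positive measure $\pi$ on $\mathbb N$ with $\pi_bL_{b,a}=\pi_aU_{a,b}$ for all $a,b$. A measure $\pi$ is invariant by $M$ if $\sum_a\pi_aM_{a,b}=\pi_b$ for all $b$. Unless otherwise stated, the paper's Markov chains on $\mathbb N$ are irreducible.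
   Formalization: Assumes Y_0=1 (throughout if v_0=0; otherwise only for the claims on U and π) and, for those claims, all Y_a>0: else the reversal fails or u is 0/0. For X not assumed pushable the printed equivalence is false; it is proved with the sum starting at i=0. *)

theory Defs
  imports "HOL-Analysis.Infinite_Sum"
begin

definition transition_matrix :: "(nat \<Rightarrow> nat \<Rightarrow> real) \<Rightarrow> bool" where
  "transition_matrix M \<longleftrightarrow> (\<forall>i j. 0 \<le> M i j) \<and> (\<forall>i. (M i has_sum 1) UNIV)"

definition descent_kernel :: "(nat \<Rightarrow> nat \<Rightarrow> real) \<Rightarrow> bool" where
  "descent_kernel D \<longleftrightarrow> transition_matrix D \<and> (\<forall>i j. D i j > 0 \<longrightarrow> j \<le> i)"

text \<open>\<open>push X D\<close> is the sequence written \<open>Y = X.D\<close>.\<close>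

definition push :: "(nat \<Rightarrow> real) \<Rightarrow> (nat \<Rightarrow> nat \<Rightarrow> real) \<Rightarrow> nat \<Rightarrow> real" where
  "push X D a = (\<Sum>\<^sub>\<infinity>b\<in>{a..}. X b * D b a)"

text \<open>The requirements on a pushable sequence other than the partial-sum condition. They are kept
  apart so that the partial-sum condition can be compared with \<open>v\<^sub>a \<in> (0,1)\<close>.\<close>

definition pre_pushable :: "real \<Rightarrow> (nat \<Rightarrow> nat \<Rightarrow> real) \<Rightarrow> (nat \<Rightarrow> real) \<Rightarrow> bool" where
  "pre_pushable v\<^sub>0 D X \<longleftrightarrow>
     X 0 = v\<^sub>0 \<and> (\<forall>i\<ge>1. X i > 0) \<and> (\<forall>a. (\<lambda>b. X b * D b a) summable_on {a..})"

definition pushable :: "real \<Rightarrow> (nat \<Rightarrow> nat \<Rightarrow> real) \<Rightarrow> (nat \<Rightarrow> real) \<Rightarrow> bool" where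
  "pushable v\<^sub>0 D X \<longleftrightarrow> pre_pushable v\<^sub>0 D X \<and>
     (\<forall>a\<ge>1. (\<Sum>i=1..a. push X D i / push X D 0 - X i) > 0)"

text \<open>For \<open>v\<^sub>0 = 0\<close> the general formula at \<open>a = 0\<close> would contain \<open>X\<^sub>0 (1 / v\<^sub>0 - 1) = 0 \<cdot> \<infinity>\<close>, hence the
  separate case. The resulting matrices satisfy detailed balance only when \<open>Y\<^sub>0 = 1\<close>: since
  \<open>D\<^sub>0\<^sub>0 = 1\<close>, the diagonal entries at \<open>0\<close> are \<open>L\<^sub>0\<^sub>0 = v\<^sub>0\<close> and \<open>U\<^sub>0\<^sub>0 = X\<^sub>0 / Y\<^sub>0 = v\<^sub>0 / Y\<^sub>0\<close>.\<close>

primrec pushed_v :: "real \<Rightarrow> (nat \<Rightarrow> real) \<Rightarrow> (nat \<Rightarrow> real) \<Rightarrow> nat \<Rightarrow> real" where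
  "pushed_v v\<^sub>0 X Y 0 = v\<^sub>0"
| "pushed_v v\<^sub>0 X Y (Suc a) =
     (if a = 0 \<and> v\<^sub>0 = 0 then X 1 / Y 0 * (1 - Y 1 / (Y 0 + Y 1))
      else X (Suc a) / (Y (Suc a) / Y 0 + X a * (1 / pushed_v v\<^sub>0 X Y a - 1)))"

text \<open>\<open>u\<^sub>a = 0\<close> (equivalently \<open>Y\<^sub>a = 0\<close>) makes the quotient for \<open>u\<^sub>a\<^sub>+\<^sub>1\<close> the undefined \<open>0 / 0\<close>, so these
  recursions are meaningful only when every \<open>Y\<^sub>a\<close> is positive.\<close>

primrec pushed_u :: "(nat \<Rightarrow> real) \<Rightarrow> (nat \<Rightarrow> real) \<Rightarrow> nat \<Rightarrow> real" where
  "pushed_u v Y 0 = 1"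
| "pushed_u v Y (Suc a) =
     Y (Suc a) * pushed_u v Y a / (Y a * (1 - v a) + Y (Suc a) * pushed_u v Y a)"

primrec pushed_measure ::
  "(nat \<Rightarrow> real) \<Rightarrow> (nat \<Rightarrow> real) \<Rightarrow> (nat \<Rightarrow> real) \<Rightarrow> nat \<Rightarrow> real" where
  "pushed_measure v u Y 0 = Y 0"
| "pushed_measure v u Y (Suc a) = pushed_measure v u Y a * ((1 - v a) / (1 - u (Suc a)))"

text \<open>The almost lower-triangular matrix with descent representation \<open>(v, D)\<close>.\<close>

definition lower_matrix :: "(nat \<Rightarrow> real) \<Rightarrow> (nat \<Rightarrow> nat \<Rightarrow> real) \<Rightarrow> nat \<Rightarrow> nat \<Rightarrow> real" where
  "lower_matrix v D b a = (if a \<le> b then v b * D b a else if a = Suc b then 1 - v b else 0)"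

text \<open>The subdiagonal condition is \<open>a = b + 1\<close>, so row \<open>0\<close> has no such entry; there the
  corresponding weight \<open>1 - u 0\<close> is \<open>0\<close>.\<close>

definition upper_matrix :: "(nat \<Rightarrow> real) \<Rightarrow> (nat \<Rightarrow> real) \<Rightarrow> (nat \<Rightarrow> real) \<Rightarrow>
    (nat \<Rightarrow> nat \<Rightarrow> real) \<Rightarrow> nat \<Rightarrow> nat \<Rightarrow> real" where
  "upper_matrix u \<alpha> \<beta> D a b =
     (if a \<le> b then u a * \<alpha> a * \<beta> b * D b a else if a = Suc b then 1 - u a else 0)"

definition time_reversal :: "(nat \<Rightarrow> nat \<Rightarrow> real) \<Rightarrow> (nat \<Rightarrow> nat \<Rightarrow> real) \<Rightarrow> bool" where
  "time_reversal L U \<longleftrightarrow>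
     (\<exists>\<pi>. (\<forall>a. \<pi> a > 0) \<and> (\<forall>a b. \<pi> b * L b a = \<pi> a * U a b))"

definition invariant_measure :: "(nat \<Rightarrow> real) \<Rightarrow> (nat \<Rightarrow> nat \<Rightarrow> real) \<Rightarrow> bool" where
  "invariant_measure \<pi> M \<longleftrightarrow>
     (\<forall>a. \<pi> a \<ge> 0) \<and> (\<forall>b. ((\<lambda>a. \<pi> a * M a b) has_sum \<pi> b) UNIV)"

end

theory Submission
  imports Defs
begin

text \<open>
  Everything is governed by the partial sums
  \<open>S\<^sub>a = (\<Sum>i=0..a. Y\<^sub>i / Y\<^sub>0 - X\<^sub>i)\<close>, which start at \<open>S\<^sub>0 = 1 - v\<^sub>0 > 0\<close>. Since
  \<open>S\<^sub>a\<^sub>+\<^sub>1 + X\<^sub>a\<^sub>+\<^sub>1 = S\<^sub>a + Y\<^sub>a\<^sub>+\<^sub>1 / Y\<^sub>0\<close>, the recursion for \<open>v\<close> says that the quantity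
  \<open>X\<^sub>a (1 / v\<^sub>a - 1)\<close> has the same increments as \<open>S\<^sub>a\<close>, so the recursion is solved by
  \<open>v\<^sub>a = X\<^sub>a / (S\<^sub>a + X\<^sub>a)\<close> (lemma \<open>pushed_v_closed_form\<close>). For \<open>v\<^sub>0 = 0\<close> the
  separately prescribed \<open>v\<^sub>1 = X\<^sub>1 / (Y\<^sub>0 + Y\<^sub>1)\<close> fits this formula because then \<open>Y\<^sub>0 = 1\<close>.
  As \<open>X\<^sub>a > 0\<close> for \<open>a > 0\<close>, the value \<open>v\<^sub>a\<close> lies in \<open>(0,1)\<close> exactly when \<open>S\<^sub>a > 0\<close>; and \<open>S\<^sub>a\<close> exceeds the sum from \<open>1\<close> to \<open>a\<close> by \<open>S\<^sub>0 > 0\<close>.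

  Now let \<open>Y\<^sub>0 = 1\<close> and \<open>Y > 0\<close>. The recursions for \<open>u\<close> and \<open>\<pi>\<close> are designed so that
  \<open>\<pi>\<^sub>a u\<^sub>a = Y\<^sub>a\<close>, and then \<open>\<pi>\<^sub>a\<^sub>+\<^sub>1 = \<pi>\<^sub>a (1 - v\<^sub>a) + Y\<^sub>a\<^sub>+\<^sub>1\<close>, whose solution is
  \<open>\<pi>\<^sub>a = S\<^sub>a + X\<^sub>a\<close>. By the closed form of \<open>v\<close> this means \<open>\<pi>\<^sub>a v\<^sub>a = X\<^sub>a\<close>. The two identities give the
  two halves of the claim: \<open>\<pi>\<^sub>b v\<^sub>b = X\<^sub>b\<close> is detailed balance between \<open>L\<close> and \<open>U\<close> on and below the
  diagonal of \<open>L\<close> (above it, detailed balance is the recursion for \<open>\<pi>\<close>), and \<open>\<pi>\<^sub>a u\<^sub>a = Y\<^sub>a\<close> makes the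
  rows of \<open>U\<close> sum to one, because the column sum \<open>\<Sum>b\<ge>a. X\<^sub>b D\<^sub>b\<^sub>a\<close> is \<open>Y\<^sub>a\<close>. A measure
  in detailed balance with two transition matrices is invariant for both.
\<close>

section \<open>Descent kernels and pushed sequences\<close>

lemma descent_kernel_nonneg: "descent_kernel D \<Longrightarrow> 0 \<le> D i j"
  by (simp add: descent_kernel_def transition_matrix_def)

lemma descent_kernel_eq_0:
  assumes "descent_kernel D" "i < j"
  shows "D i j = 0"
proof -
  have "\<not> D i j > 0"
    using assms by (auto simp: descent_kernel_def not_le[symmetric])
  with descent_kernel_nonneg[OF assms(1), of i j] show ?thesis
    by linarith
qed

lemma descent_kernel_00:
  assumes "descent_kernel D"
  shows "D 0 0 = 1"
proof -
  have "(D 0 has_sum 1) UNIV"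
    using assms by (simp add: descent_kernel_def transition_matrix_def)
  then have "(D 0 has_sum 1) {0}"
    by (rule has_sum_cong_neutral[THEN iffD1, rotated -1])
       (auto simp: descent_kernel_eq_0[OF assms])
  moreover have "(D 0 has_sum D 0 0) {0}"
    using has_sum_finite[of "{0}" "D 0"] by simp
  ultimately show ?thesis
    by (rule has_sum_unique[symmetric])
qed

lemma pre_pushable_nonneg:
  assumes "pre_pushable v\<^sub>0 D X" "0 \<le> v\<^sub>0"
  shows "0 \<le> X i"
  using assms by (cases i) (auto simp: pre_pushable_def intro: less_imp_le)

lemma push_nonneg:
  assumes "descent_kernel D" "pre_pushable v\<^sub>0 D X" "0 \<le> v\<^sub>0"
  shows "0 \<le> push X D a"
  unfolding push_def
  by (intro infsum_nonneg mult_nonneg_nonneg pre_pushable_nonneg[OF assms(2,3)]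
      descent_kernel_nonneg[OF assms(1)])

text \<open>The terms with \<open>b < a\<close> vanish, so \<open>X.D\<close> is the ordinary product of a row vector with a matrix.\<close>

lemma push_has_sum:
  assumes D: "descent_kernel D" and X: "pre_pushable v\<^sub>0 D X"
  shows "((\<lambda>b. X b * D b a) has_sum push X D a) UNIV"
proof -
  have "((\<lambda>b. X b * D b a) has_sum push X D a) {a..}"
    unfolding push_def using X by (intro has_sum_infsum) (simp add: pre_pushable_def)
  then show ?thesis
    by (rule has_sum_cong_neutral[THEN iffD1, rotated -1])
       (auto simp: descent_kernel_eq_0[OF D])
qed

text \<open>The row condition \<open>D\<^sub>0\<^sub>0 = 1\<close> puts all the mass \<open>X\<^sub>0 = v\<^sub>0\<close> at the origin into \<open>Y\<^sub>0\<close>.\<close>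

lemma push_0_ge:
  assumes D: "descent_kernel D" and X: "pre_pushable v\<^sub>0 D X" and "0 \<le> v\<^sub>0"
  shows "v\<^sub>0 \<le> push X D 0"
proof -
  have "(\<Sum>b\<in>{0}. X b * D b 0) \<le> (\<Sum>\<^sub>\<infinity>b\<in>{0..}. X b * D b 0)"
    using has_sum_imp_summable[OF push_has_sum[OF D X, of 0]]
      pre_pushable_nonneg[OF X \<open>0 \<le> v\<^sub>0\<close>] descent_kernel_nonneg[OF D]
    by (intro finite_sum_le_infsum) auto
  then show ?thesis
    using X by (simp add: push_def descent_kernel_00[OF D] pre_pushable_def)
qed

section \<open>Solving the recursion for the descent probabilities\<close>

text \<open>The invariant of the recursion is \<open>X\<^sub>a (1 / v\<^sub>a - 1) = S\<^sub>a\<close>. With the convention \<open>x / 0 = 0\<close> it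
  also survives a vanishing denominator \<open>d\<close>, because \<open>x / (x / d) = d\<close> for every \<open>d\<close> once
  \<open>x \<noteq> 0\<close>. The closed form thus covers sequences with \<open>S\<^sub>a \<le> 0\<close> for some \<open>a\<close>, about which the
  equivalence with \<open>v\<^sub>a \<in> (0,1)\<close> makes a claim as well.\<close>

lemma pushed_v_closed_form:
  fixes X Y :: "nat \<Rightarrow> real"
  defines "S \<equiv> \<lambda>a. \<Sum>i=0..a. Y i / Y 0 - X i"
  assumes "X 0 = v\<^sub>0" and pos: "\<And>i. i \<ge> 1 \<Longrightarrow> X i > 0"
    and nonneg: "\<And>i. 0 \<le> Y i" and "Y 0 \<noteq> 0" and norm: "v\<^sub>0 = 0 \<Longrightarrow> Y 0 = 1"
  shows "pushed_v v\<^sub>0 X Y a = X a / (S a + X a)"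
proof (induction a)
  case 0
  then show ?case
    using \<open>X 0 = v\<^sub>0\<close> \<open>Y 0 \<noteq> 0\<close> by (simp add: S_def)
next
  case (Suc a)
  have S_Suc: "S (Suc a) + X (Suc a) = S a + Y (Suc a) / Y 0"
    by (simp add: S_def)
  show ?case
  proof (cases "a = 0 \<and> v\<^sub>0 = 0")
    case True
    moreover have "1 + Y 1 \<noteq> 0"
      using nonneg[of 1] by linarith
    moreover have "S 0 = 1"
      using True norm \<open>X 0 = v\<^sub>0\<close> by (simp add: S_def)
    ultimately show ?thesis
      using norm S_Suc by (simp add: field_simps)
  next
    case False
    then have "X a \<noteq> 0"
      using \<open>X 0 = v\<^sub>0\<close> pos[of a] by (cases a) auto
    then have "X a * (1 / pushed_v v\<^sub>0 X Y a - 1) = S a"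
      by (simp add: Suc right_diff_distrib)
    then show ?thesis
      using False S_Suc by (auto simp: add.commute)
  qed
qed

lemma ratio_in_unit_interval_iff:
  fixes x s :: real
  assumes "0 < x"
  shows "0 < x / (s + x) \<and> x / (s + x) < 1 \<longleftrightarrow> 0 < s"
  using assms by (auto simp: zero_less_divide_iff divide_less_eq_1)

text \<open>The sums start at \<open>0\<close>: the term \<open>S\<^sub>0 = 1 - v\<^sub>0\<close> gives slack, so that \<open>v\<^sub>a \<in> (0,1)\<close> can hold
  although the sum from \<open>1\<close> to \<open>a\<close> is negative, as long as it stays above \<open>v\<^sub>0 - 1\<close>.\<close>

lemma pushed_v_in_unit_interval_iff:
  assumes D: "descent_kernel D" and X: "pre_pushable v\<^sub>0 D X"
    and v0: "0 \<le> v\<^sub>0" and norm: "v\<^sub>0 = 0 \<longrightarrow> push X D 0 = 1"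
  defines "Y \<equiv> push X D"
  shows "pushed_v v\<^sub>0 X Y a = X a / ((\<Sum>i=0..a. Y i / Y 0 - X i) + X a)"
    and "(\<forall>a>0. 0 < pushed_v v\<^sub>0 X Y a \<and> pushed_v v\<^sub>0 X Y a < 1) \<longleftrightarrow>
         (\<forall>a\<ge>1. (\<Sum>i=0..a. Y i / Y 0 - X i) > 0)"
proof -
  have pos: "X i > 0" if "i \<ge> 1" for i
    using X that by (simp add: pre_pushable_def)
  have "Y 0 \<noteq> 0"
    using push_0_ge[OF D X v0] norm v0 by (auto simp: Y_def)
  then have closed: "pushed_v v\<^sub>0 X Y a = X a / ((\<Sum>i=0..a. Y i / Y 0 - X i) + X a)" for a
    using X norm push_nonneg[OF D X v0]
    by (intro pushed_v_closed_form) (auto simp: pre_pushable_def Y_def)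
  then show "pushed_v v\<^sub>0 X Y a = X a / ((\<Sum>i=0..a. Y i / Y 0 - X i) + X a)" .
  show "(\<forall>a>0. 0 < pushed_v v\<^sub>0 X Y a \<and> pushed_v v\<^sub>0 X Y a < 1) \<longleftrightarrow>
         (\<forall>a\<ge>1. (\<Sum>i=0..a. Y i / Y 0 - X i) > 0)"
    unfolding closed using pos by (auto simp: ratio_in_unit_interval_iff Suc_le_eq)
qed

lemma pushed_partial_sum_pos:
  fixes X :: "nat \<Rightarrow> real"
  assumes X: "pushable v\<^sub>0 D X" and "v\<^sub>0 < 1" and "push X D 0 \<noteq> 0"
  shows "(\<Sum>i=0..a. push X D i / push X D 0 - X i) > 0"
proof -
  have "(\<Sum>i=0..a. push X D i / push X D 0 - X i) =
        (1 - v\<^sub>0) + (\<Sum>i=1..a. push X D i / push X D 0 - X i)"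
    using assms by (simp add: sum.atLeast_Suc_atMost pushable_def pre_pushable_def)
  moreover have "(\<Sum>i=1..a. push X D i / push X D 0 - X i) \<ge> 0"
    using X by (cases "a = 0") (auto simp: pushable_def Suc_le_eq intro: less_imp_le)
  ultimately show ?thesis
    using \<open>v\<^sub>0 < 1\<close> by linarith
qed

section \<open>The reversing measure\<close>

lemma pushed_u_pos:
  assumes "\<And>a. 0 < Y a" "\<And>a. v a < 1"
  shows "0 < pushed_u v Y a"
  by (induction a) (auto intro!: divide_pos_pos add_pos_pos simp: assms)

lemma pushed_u_Suc_less_1:
  assumes "\<And>a. 0 < Y a" "\<And>a. v a < 1"
  shows "pushed_u v Y (Suc a) < 1"
  using assms pushed_u_pos[of Y v a, OF assms] by (simp add: divide_less_eq_1 add_pos_pos)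

lemma pushed_measure_pos:
  assumes "\<And>a. 0 < Y a" "\<And>a. v a < 1"
  shows "0 < pushed_measure v (pushed_u v Y) Y a"
proof (induction a)
  case 0
  then show ?case by (simp add: assms)
next
  case (Suc a)
  have "0 < 1 - v a" "0 < 1 - pushed_u v Y (Suc a)"
    using assms(2)[of a] pushed_u_Suc_less_1[of Y v a, OF assms] by auto
  with Suc show ?case
    by (simp del: pushed_u.simps)
qed

text \<open>The recursion for \<open>u\<close> is what is needed for this identity to propagate: writing \<open>d\<close> for its
  denominator, \<open>1 - u\<^sub>a\<^sub>+\<^sub>1 = Y\<^sub>a (1 - v\<^sub>a) / d\<close>, hence \<open>\<pi>\<^sub>a\<^sub>+\<^sub>1 = \<pi>\<^sub>a d / Y\<^sub>a\<close>.\<close>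

lemma pushed_measure_mult_u:
  assumes "\<And>a. 0 < Y a" "\<And>a. v a < 1"
  shows "pushed_measure v (pushed_u v Y) Y a * pushed_u v Y a = Y a"
proof (induction a)
  case 0
  then show ?case by simp
next
  case (Suc a)
  let ?u = "pushed_u v Y" and ?m = "pushed_measure v (pushed_u v Y) Y"
  define d where "d = Y a * (1 - v a) + Y (Suc a) * ?u a"
  have "0 < d"
    using assms pushed_u_pos[of Y v a, OF assms] by (simp add: d_def add_pos_pos)
  have v: "1 - v a \<noteq> 0" and Y: "Y a \<noteq> 0"
    using assms(1,2)[of a] by auto
  have u: "?u (Suc a) = Y (Suc a) * ?u a / d"
    by (simp add: d_def)
  then have "1 - ?u (Suc a) = Y a * (1 - v a) / d"
    using \<open>0 < d\<close> by (simp add: d_def field_simps)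
  then have "?m (Suc a) = ?m a * d / Y a"
    using v Y \<open>0 < d\<close> by (simp del: pushed_u.simps)
  then have "?m (Suc a) * ?u (Suc a) = ?m a * ?u a * Y (Suc a) / Y a"
    using \<open>0 < d\<close> u by (simp del: pushed_measure.simps pushed_u.simps)
  then show ?case
    using Suc Y by (simp del: pushed_measure.simps pushed_u.simps)
qed

lemma pushed_measure_flow:
  assumes "\<And>a. 0 < Y a" "\<And>a. v a < 1"
  shows "pushed_measure v (pushed_u v Y) Y a * (1 - v a) =
         pushed_measure v (pushed_u v Y) Y (Suc a) * (1 - pushed_u v Y (Suc a))"
  using pushed_u_Suc_less_1[of Y v a, OF assms] by (simp del: pushed_u.simps)

text \<open>Combining the last two identities, \<open>\<pi>\<^sub>a\<^sub>+\<^sub>1 = \<pi>\<^sub>a - \<pi>\<^sub>a v\<^sub>a + Y\<^sub>a\<^sub>+\<^sub>1 = \<pi>\<^sub>a - X\<^sub>a + Y\<^sub>a\<^sub>+\<^sub>1\<close>.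
  The normalisation \<open>Y\<^sub>0 = 1\<close> is what matches this with the increments of \<open>S\<^sub>a + X\<^sub>a\<close>.\<close>

lemma pushed_measure_closed_form:
  fixes X Y :: "nat \<Rightarrow> real"
  defines "S \<equiv> \<lambda>a. \<Sum>i=0..a. Y i / Y 0 - X i"
  assumes "\<And>a. 0 < Y a" "\<And>a. v a < 1" and "Y 0 = 1"
    and v: "\<And>a. v a * (S a + X a) = X a"
  shows "pushed_measure v (pushed_u v Y) Y a = S a + X a"
proof (induction a)
  case 0
  then show ?case using \<open>Y 0 = 1\<close> by (simp add: S_def)
next
  case (Suc a)
  let ?m = "pushed_measure v (pushed_u v Y) Y"
  have "?m (Suc a) = ?m (Suc a) * pushed_u v Y (Suc a) + ?m (Suc a) * (1 - pushed_u v Y (Suc a))"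
    by (simp add: right_diff_distrib del: pushed_measure.simps pushed_u.simps)
  also have "\<dots> = Y (Suc a) + ?m a * (1 - v a)"
    using pushed_measure_mult_u[of Y v "Suc a", OF assms(2,3)]
      pushed_measure_flow[of Y v a, OF assms(2,3)] by linarith
  also have "?m a * (1 - v a) = S a"
    using v[of a] Suc by (simp add: algebra_simps)
  finally show ?case
    using \<open>Y 0 = 1\<close> by (simp add: S_def)
qed

section \<open>The two transition matrices\<close>

text \<open>A point mass stands for the one entry of each row outside the part governed by \<open>D\<close>.\<close>

lemma has_sum_point_mass:
  fixes c :: real
  shows "((\<lambda>b. if b = a then c else 0) has_sum c) UNIV"
proof -
  have "((\<lambda>b. if b = a then c else 0) has_sum c) {a}"
    using has_sum_finite[of "{a}" "\<lambda>b. if b = a then c else 0"] by simp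
  then show ?thesis
    by (rule has_sum_cong_neutral[THEN iffD1, rotated -1]) auto
qed

lemma transition_matrix_lower_matrix:
  assumes D: "descent_kernel D" and v: "\<And>a. 0 \<le> v a" "\<And>a. v a \<le> 1"
  shows "transition_matrix (lower_matrix v D)"
  unfolding transition_matrix_def
proof (intro conjI allI)
  show "0 \<le> lower_matrix v D b a" for b a
    using v descent_kernel_nonneg[OF D] by (simp add: lower_matrix_def)
  show "(lower_matrix v D b has_sum 1) UNIV" for b
  proof -
    have "(D b has_sum 1) UNIV"
      using D by (simp add: descent_kernel_def transition_matrix_def)
    then have "((\<lambda>a. v b * D b a + (if a = Suc b then 1 - v b else 0)) has_sum
        v b * 1 + (1 - v b)) UNIV"
      by (intro has_sum_add has_sum_cmult_right has_sum_point_mass)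
    moreover have "lower_matrix v D b =
        (\<lambda>a. v b * D b a + (if a = Suc b then 1 - v b else 0))"
      by (auto simp: lower_matrix_def descent_kernel_eq_0[OF D])
    ultimately show ?thesis
      by simp
  qed
qed

text \<open>The hypothesis \<open>u\<^sub>a \<alpha>\<^sub>a Y\<^sub>a = u\<^sub>a\<close> says that the ascending part of row \<open>a\<close> has total mass \<open>u\<^sub>a\<close>;
  row \<open>0\<close> has no descending entry to carry the rest, which is why \<open>u\<^sub>0 = 1\<close>.\<close>

lemma transition_matrix_upper_matrix:
  assumes D: "descent_kernel D" and X: "pre_pushable v\<^sub>0 D X" and v0: "0 \<le> v\<^sub>0"
    and u: "\<And>a. 0 \<le> u a" "\<And>a. u a \<le> 1" "u 0 = 1"
    and \<alpha>: "\<And>a. 0 \<le> \<alpha> a" and mass: "\<And>a. u a * \<alpha> a * push X D a = u a"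
  shows "transition_matrix (upper_matrix u \<alpha> X D)"
  unfolding transition_matrix_def
proof (intro conjI allI)
  show "0 \<le> upper_matrix u \<alpha> X D a b" for a b
    using u \<alpha> descent_kernel_nonneg[OF D] pre_pushable_nonneg[OF X v0]
    by (simp add: upper_matrix_def)
  show "(upper_matrix u \<alpha> X D a has_sum 1) UNIV" for a
  proof -
    have "((\<lambda>b. u a * \<alpha> a * (X b * D b a) + (if b = a - 1 then 1 - u a else 0)) has_sum
        u a * \<alpha> a * push X D a + (1 - u a)) UNIV"
      using push_has_sum[OF D X] by (intro has_sum_add has_sum_cmult_right has_sum_point_mass)
    \<comment> \<open>In row \<open>0\<close> truncated subtraction puts the extra mass on the diagonal, but that mass is \<open>0\<close>.\<close>
    moreover have "upper_matrix u \<alpha> X D a =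
        (\<lambda>b. u a * \<alpha> a * (X b * D b a) + (if b = a - 1 then 1 - u a else 0))"
      using u(3) by (cases a) (auto simp: upper_matrix_def descent_kernel_eq_0[OF D])
    ultimately show ?thesis
      by (simp add: mass)
  qed
qed

lemma invariant_measure_of_detailed_balance:
  assumes "\<And>a. 0 \<le> \<pi> a" and balance: "\<And>a b. \<pi> b * L b a = \<pi> a * U a b"
    and U: "transition_matrix U"
  shows "invariant_measure \<pi> L"
  unfolding invariant_measure_def
proof (intro conjI allI)
  fix a
  have "((\<lambda>b. \<pi> a * U a b) has_sum \<pi> a * 1) UNIV"
    using U by (intro has_sum_cmult_right) (simp add: transition_matrix_def)
  then show "((\<lambda>b. \<pi> b * L b a) has_sum \<pi> a) UNIV"
    by (simp add: balance)
qed (use assms in auto)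

lemma detailed_balance_lower_upper:
  assumes flow: "\<And>a. \<pi> a * (1 - v a) = \<pi> (Suc a) * (1 - u (Suc a))"
    and "\<And>a. \<pi> a * v a = X a" and "\<And>a. \<pi> a * u a \<noteq> 0"
  shows "\<pi> b * lower_matrix v D b a =
         \<pi> a * upper_matrix u (\<lambda>a. 1 / (u a * \<pi> a)) X D a b"
proof (cases "a \<le> b")
  case True
  have "\<pi> b * lower_matrix v D b a = X b * D b a"
    using True assms(2)[of b] by (simp add: lower_matrix_def)
  also have "\<dots> = \<pi> a * (u a * (1 / (u a * \<pi> a)) * X b * D b a)"
    using assms(3)[of a] by simp
  finally show ?thesis
    using True by (simp add: upper_matrix_def)
next
  case False
  then show ?thesis
    using flow[of b] by (auto simp: lower_matrix_def upper_matrix_def)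
qed

section \<open>Time reversal of a matrix with a pushed descent representation\<close>

theorem theorem3p9:
  fixes v\<^sub>0 :: real
    and D L U :: "nat \<Rightarrow> nat \<Rightarrow> real"
    and X Y v u \<alpha> \<beta> \<pi> :: "nat \<Rightarrow> real"
  assumes "0 \<le> v\<^sub>0" and "v\<^sub>0 < 1"
    and "descent_kernel D"
    and "pushable v\<^sub>0 D X"
    and "Y = push X D"
    and "v\<^sub>0 = 0 \<longrightarrow> Y 0 = 1"
    and "v = pushed_v v\<^sub>0 X Y"
    and "u = pushed_u v Y"
    and "\<pi> = pushed_measure v u Y"
    and "\<beta> = X"
    and "\<alpha> = (\<lambda>a. 1 / (u a * \<pi> a))"
    and "L = lower_matrix v D"
    and "U = upper_matrix u \<alpha> \<beta> D"
  shows "(\<forall>a>0. 0 < v a \<and> v a < 1) \<and>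
    ((\<forall>a>0. 0 < v a \<and> v a < 1) \<longleftrightarrow> (\<forall>a\<ge>1. (\<Sum>i=1..a. Y i / Y 0 - X i) > 0)) \<and>
    (\<forall>X' Y' v'. pre_pushable v\<^sub>0 D X' \<and> Y' = push X' D \<and> (v\<^sub>0 = 0 \<longrightarrow> Y' 0 = 1) \<and>
        v' = pushed_v v\<^sub>0 X' Y' \<longrightarrow>
      ((\<forall>a>0. 0 < v' a \<and> v' a < 1) \<longleftrightarrow> (\<forall>a\<ge>1. (\<Sum>i=0..a. Y' i / Y' 0 - X' i) > 0))) \<and>
    transition_matrix L \<and>
    (Y 0 = 1 \<and> (\<forall>a. Y a > 0) \<longrightarrow>
      transition_matrix U \<and> time_reversal L U \<and>
      invariant_measure \<pi> L \<and> invariant_measure \<pi> U)"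
proof -
  have D: "descent_kernel D" and X: "pre_pushable v\<^sub>0 D X"
    using assms(3,4) by (auto simp: pushable_def)
  define S where "S a = (\<Sum>i=0..a. Y i / Y 0 - X i)" for a
  have "Y 0 \<noteq> 0"
    using push_0_ge[OF D X assms(1)] assms(1,5,6) by auto
  then have S_pos: "S a > 0" for a
    using pushed_partial_sum_pos[OF assms(4,2)] assms(5) by (simp add: S_def)
  have v_eq: "v a = X a / (S a + X a)" for a
    using pushed_v_in_unit_interval_iff(1)[OF D X assms(1)] assms(5-7) by (simp add: S_def)
  have v_unit: "\<forall>a>0. 0 < v a \<and> v a < 1"
    using pushed_v_in_unit_interval_iff(2)[OF D X assms(1)] assms(5-7) S_pos
    by (simp add: S_def)
  have X_nonneg: "0 \<le> X a" for a
    using pre_pushable_nonneg[OF X assms(1)] .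
  have v_nonneg: "0 \<le> v a" and v_less: "v a < 1" and v_mult: "v a * (S a + X a) = X a" for a
    using S_pos[of a] X_nonneg[of a] by (simp_all add: v_eq)
  have sums: "\<forall>a\<ge>1. (\<Sum>i=1..a. Y i / Y 0 - X i) > 0"
    using assms(4,5) by (simp add: pushable_def)
  have equiv: "\<forall>X' Y' v'. pre_pushable v\<^sub>0 D X' \<and> Y' = push X' D \<and> (v\<^sub>0 = 0 \<longrightarrow> Y' 0 = 1) \<and>
        v' = pushed_v v\<^sub>0 X' Y' \<longrightarrow>
      ((\<forall>a>0. 0 < v' a \<and> v' a < 1) \<longleftrightarrow> (\<forall>a\<ge>1. (\<Sum>i=0..a. Y' i / Y' 0 - X' i) > 0))"
    using pushed_v_in_unit_interval_iff(2)[OF D _ assms(1)] by blast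
  have L_trans: "transition_matrix L"
    using transition_matrix_lower_matrix[OF D v_nonneg less_imp_le[OF v_less]] assms(12) by simp
  have reversal: "transition_matrix U \<and> time_reversal L U \<and>
      invariant_measure \<pi> L \<and> invariant_measure \<pi> U" if Y: "Y 0 = 1 \<and> (\<forall>a. Y a > 0)"
  proof -
    have Y_pos: "Y a > 0" for a
      using Y by simp
    have u_pos: "u a > 0" and \<pi>_pos: "\<pi> a > 0" and \<pi>u: "\<pi> a * u a = Y a" for a
      using pushed_u_pos[of Y v a, OF Y_pos v_less] pushed_measure_pos[of Y v a, OF Y_pos v_less]
        pushed_measure_mult_u[of Y v a, OF Y_pos v_less] assms(8,9) by simp_all
    have u_le: "u a \<le> 1" for a
      using pushed_u_Suc_less_1[of Y v, OF Y_pos v_less] assms(8)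
      by (cases a) (auto simp del: pushed_u.simps(2) intro: less_imp_le)
    have \<pi>v: "\<pi> a * v a = X a" for a
      using pushed_measure_closed_form[of Y v X a, OF Y_pos v_less] Y v_mult assms(8,9)
      by (simp add: S_def mult.commute)
    have balance: "\<pi> b * L b a = \<pi> a * U a b" for a b
      using detailed_balance_lower_upper[of \<pi> v u X b D a]
        pushed_measure_flow[of Y v, OF Y_pos v_less] \<pi>v \<pi>u Y_pos assms(8-13)
      by (metis less_irrefl)
    have U_trans: "transition_matrix U"
      unfolding assms(13) assms(10)
    proof (rule transition_matrix_upper_matrix[OF D X assms(1)])
      show "0 \<le> u a" "0 \<le> \<alpha> a" for a
        using u_pos[of a] \<pi>_pos[of a] assms(11) by auto
      show "u a * \<alpha> a * push X D a = u a" for a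
        using u_pos[of a] \<pi>_pos[of a] \<pi>u[of a] assms(5,11)
        by (auto simp: divide_eq_eq mult.commute)
    qed (use u_le assms(8) in simp_all)
    have \<pi>_nonneg: "0 \<le> \<pi> a" for a
      using \<pi>_pos by (simp add: less_imp_le)
    have "time_reversal L U"
      unfolding time_reversal_def using \<pi>_pos balance by blast
    then show ?thesis
      using U_trans invariant_measure_of_detailed_balance[of \<pi> L U, OF \<pi>_nonneg balance U_trans]
        invariant_measure_of_detailed_balance[of \<pi> U L, OF \<pi>_nonneg balance[symmetric] L_trans]
      by blast
  qed
  show ?thesis
    using v_unit sums equiv L_trans reversal by blast
qed

end
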